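(* $T'=HOM\circ LT'$: the top-down tree transformations with regular look-ahead are exactly the compositions of a tree homomorphism followed by a linear top-down tree transformation with regular look-ahead.
   Context: Alphabets are finite. A ranked alphabet $\Sigma$ is a finite set of symbols with, for each $k\ge 0$, a subset $\Sigma_k$ (symbols of rank $k$; a symbol may have several ranks), $\Sigma=\bigcup_k\Sigma_k$, only finitely many $\Sigma_k$ nonempty. $T_\Sigma$ is the set of trees over $\Sigma$: $a\in T_\Sigma$ for $a\in\Sigma_0$, and $a[t_1\cdots t_k]\in T_\Sigma$ for $k\ge1$, $a\in\Sigma_k$, $t_i\in T_\Sigma$. For a set $S$ of trees or of new symbols (regarded as having rank $0$), $T_\Sigma(S)$ is the smallest set containing $S\cup\Sigma_0$ and closed under $(t_1,\dots,t_k)\mapsto a[t_1\cdots t_k]$ for $k\ge1$, $a\in\Sigma_k$. A tree transformation from $T_\Sigma$ into $T_\Delta$ is a subset of $T_\Sigma\times T_\Delta$; maps are identified with their graphs. $M_1\circ M_2=\{(s,t)\mid (s,u)\in M_1,(u,t)\in M_2\text{ for some }u\in T_\Delta\}$ for $M_1\subseteq T_\Sigma\times T_\Delta$, $M_2\subseteq T_\Delta\times T_\Omega$ ($M_1$ applied first); $F\circ G=\{M_1\circ M_2\mid M_1\in F,M_2\in G\}$. Variables: $X_k=\{x_1,\dots,x_k\}$, $X_0=\emptyset$. $HOM$: a tree homomorphism is a family of maps $h_k:\Sigma_k\to T_\Delta(X_k)$ ($k\ge0$), determining $h:T_\Sigma\to T_\Delta$ by $h(a)=h_0(a)$ and $h(a[t_1\cdots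 t_k])=h_k(a)\langle x_1\gets h(t_1),\dots,x_k\gets h(t_k)\rangle$ (simultaneous substitution). $L\subseteq T_\Sigma$ is recognizable if $L=\{t\in T_\Sigma\mid\widehat\delta(t)\in F\}$ for some finite set $Q$, $F\subseteq Q$, $s_a\in Q$ ($a\in\Sigma_0$), $\delta_a^k:Q^k\to Q$ ($k\ge1,a\in\Sigma_k$), where $\widehat\delta(a)=s_a$, $\widehat\delta(a[t_1\cdots t_k])=\delta_a^k(\widehat\delta(t_1),\dots,\widehat\delta(t_k))$. A top-down finite tree transducer with regular look-ahead is $M=(Q,\Sigma,\Delta,R,Q_d)$, where $Q$ is a finite set of states, regarded as symbols of rank $1$ only and disjoint from $\Sigma\cup\Delta$, $Q_d\subseteq Q$ (initial states), and $R$ is a finite set of rules $(v\to w,D)$, where $v\to w$ has the form $q[a[x_1\cdots x_k]]\to t$ ($k\ge1$, $a\in\Sigma_k$, $q\in Q$, $t\in T_\Delta(Q[X_k])$, $Q[X_k]=\{q[x]\mid q\in Q,x\in X_k\}$) or $q[a]\to t$ ($a\in\Sigma_0$, $q\in Q$, $t\in T_\Delta$), and $D$ assigns to each $x_i$, $1\le i\le k$, a recognizable range $D(x_i)\subseteq T_\Sigma$. Rules rewrite trees over $Q\cup\Sigma\cup\Delta$: $s\Rightarrow s'$ if $s'$ arises from $s$ by replacing one occurrence of a subtree $v\langle x_1\gets\phi_1,\dots,x_k\gets\phi_k\rangle$ by $w\langle x_1\gets\phi_1,\dots,x_k\gets\phi_k\rangle$ for a rule $(v\to w,D)$ and some $\phi_i\in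 D(x_i)$. $M$ realizes $\{(s,t)\in T_\Sigma\times T_\Delta\mid q[s]\Rightarrow^*t\text{ for some }q\in Q_d\}$. $M$ is linear if no variable occurs more than once in the right hand side of a rule. $T'$ (resp. $LT'$) is the class of tree transformations realized by arbitrary (resp. linear) top-down finite tree transducers with regular look-ahead. *)

theory Defs
  imports "HOL-Library.Infinite_Typeclass"
begin

text \<open>
  All symbols are drawn from one universe \<open>'a\<close>. The ranked alphabet with the sets
  \<open>\<Sigma>\<^sub>0, \<Sigma>\<^sub>1, \<dots>\<close> is the function \<open>k \<mapsto> \<Sigma>\<^sub>k\<close>; a symbol may have several ranks.
\<close>

type_synonym 'a ranked = "nat \<Rightarrow> 'a set"

definition ranked_alphabet :: "'a ranked \<Rightarrow> bool" where
  "ranked_alphabet \<Sigma> \<longleftrightarrow> (\<forall>k. finite (\<Sigma> k)) \<and> finite {k. \<Sigma> k \<noteq> {}}"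

text \<open>
  \<open>Node a []\<close> is the one-node tree \<open>a\<close>, and \<open>Node a [t\<^sub>1, \<dots>, t\<^sub>k]\<close> is \<open>a[t\<^sub>1 \<dots> t\<^sub>k]\<close>.
  The variables are numbered from zero, \<open>Var i\<close> is \<open>x\<^sub>i\<^sub>+\<^sub>1\<close>, and \<open>xvars k\<close> is \<open>X\<^sub>k\<close>.
\<close>

datatype 'a tree = Var nat | Node 'a "'a tree list"

definition xvars :: "nat \<Rightarrow> 'a tree set" where
  "xvars k = Var ` {..<k}"

text \<open>\<open>trees_over \<Sigma> S\<close> is \<open>T\<^sub>\<Sigma>(S)\<close>.\<close>

inductive_set trees_over :: "'a ranked \<Rightarrow> 'a tree set \<Rightarrow> 'a tree set"
  for \<Sigma> :: "'a ranked" and S :: "'a tree set" where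
  base: "t \<in> S \<Longrightarrow> t \<in> trees_over \<Sigma> S"
| node: "a \<in> \<Sigma> (length ts) \<Longrightarrow> \<forall>t\<in>set ts. t \<in> trees_over \<Sigma> S \<Longrightarrow> Node a ts \<in> trees_over \<Sigma> S"

abbreviation trees :: "'a ranked \<Rightarrow> 'a tree set" where
  "trees \<Sigma> \<equiv> trees_over \<Sigma> {}"

fun subst :: "(nat \<Rightarrow> 'a tree) \<Rightarrow> 'a tree \<Rightarrow> 'a tree" where
  "subst \<phi> (Var i) = \<phi> i"
| "subst \<phi> (Node a ts) = Node a (map (subst \<phi>) ts)"

fun var_list :: "'a tree \<Rightarrow> nat list" where
  "var_list (Var i) = [i]"
| "var_list (Node a ts) = concat (map var_list ts)"


text \<open>
  A transformation is kept together with its input and output alphabets: \<open>(\<Sigma>, \<Delta>, M)\<close>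
  stands for \<open>M \<subseteq> T\<^sub>\<Sigma> \<times> T\<^sub>\<Delta>\<close>. Two transformations compose if the output alphabet of the
  first is the input alphabet of the second; \<open>M\<^sub>1 O M\<^sub>2\<close> applies \<open>M\<^sub>1\<close> first.
\<close>

type_synonym 'a transformation = "'a ranked \<times> 'a ranked \<times> ('a tree \<times> 'a tree) set"

definition class_comp ::
  "'a transformation set \<Rightarrow> 'a transformation set \<Rightarrow> 'a transformation set"  (infixr "\<odot>" 75) where
  "F \<odot> G = {(\<Sigma>, \<Omega>, M\<^sub>1 O M\<^sub>2) | \<Sigma> \<Delta> \<Omega> M\<^sub>1 M\<^sub>2. (\<Sigma>, \<Delta>, M\<^sub>1) \<in> F \<and> (\<Delta>, \<Omega>, M\<^sub>2) \<in> G}"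


text \<open>The tree \<open>h\<^sub>k(a)\<close> is \<open>h k a\<close>. The equation for \<open>Var\<close> only makes the function total.\<close>

fun hom_ext :: "(nat \<Rightarrow> 'a \<Rightarrow> 'a tree) \<Rightarrow> 'a tree \<Rightarrow> 'a tree" where
  "hom_ext h (Var i) = Var i"
| "hom_ext h (Node a ts) = subst (\<lambda>i. map (hom_ext h) ts ! i) (h (length ts) a)"

definition HOM :: "'a transformation set" where
  "HOM = {(\<Sigma>, \<Delta>, {(t, hom_ext h t) | t. t \<in> trees \<Sigma>}) | \<Sigma> \<Delta> h.
     ranked_alphabet \<Sigma> \<and> ranked_alphabet \<Delta> \<and>
     (\<forall>k. \<forall>a\<in>\<Sigma> k. h k a \<in> trees_over \<Delta> (xvars k))}"


text \<open>
  \<open>\<delta> a [p\<^sub>1, \<dots>, p\<^sub>k]\<close> is \<open>\<delta>\<^sup>k\<^sub>a(p\<^sub>1, \<dots>, p\<^sub>k)\<close>, with \<open>\<delta> a []\<close> for \<open>s\<^sub>a\<close>. Automaton states are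
  natural numbers, which covers every finite state set up to renaming. The value of
  \<open>dhat\<close> on \<open>Var\<close> is irrelevant.
\<close>

fun dhat :: "('a \<Rightarrow> nat list \<Rightarrow> nat) \<Rightarrow> 'a tree \<Rightarrow> nat" where
  "dhat \<delta> (Var i) = undefined"
| "dhat \<delta> (Node a ts) = \<delta> a (map (dhat \<delta>) ts)"

definition recognizable :: "'a ranked \<Rightarrow> 'a tree set \<Rightarrow> bool" where
  "recognizable \<Sigma> L \<longleftrightarrow>
     (\<exists>Q F \<delta>. finite Q \<and> F \<subseteq> Q \<and>
        (\<forall>k. \<forall>a\<in>\<Sigma> k. \<forall>ps. length ps = k \<and> set ps \<subseteq> Q \<longrightarrow> \<delta> a ps \<in> Q) \<and>
        L = {t \<in> trees \<Sigma>. dhat \<delta> t \<in> F})"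


text \<open>
  The rule \<open>(q[a[x\<^sub>1 \<dots> x\<^sub>k]] \<rightarrow> t, D)\<close> has \<open>rstate = q\<close>, \<open>rsym = a\<close>, \<open>rank = k\<close>,
  \<open>rhs = t\<close> and \<open>look i = D(x\<^sub>i\<^sub>+\<^sub>1)\<close> for \<open>i < k\<close>; other values of \<open>look\<close> are not used.
  States are symbols of the same universe \<open>'a\<close>, used with rank one.
\<close>

record 'a rule =
  rstate :: 'a
  rsym :: 'a
  rank :: nat
  rhs :: "'a tree"
  look :: "nat \<Rightarrow> 'a tree set"

definition lhs :: "'a rule \<Rightarrow> 'a tree" where
  "lhs r = Node (rstate r) [Node (rsym r) (map Var [0..<rank r])]"

record 'a tdtt =
  states :: "'a set"
  inp :: "'a ranked"
  out :: "'a ranked"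
  rules :: "'a rule set"
  initial :: "'a set"

definition state_calls :: "'a set \<Rightarrow> nat \<Rightarrow> 'a tree set" where
  "state_calls Q k = {Node q [x] | q x. q \<in> Q \<and> x \<in> xvars k}"

definition wf_rule :: "'a tdtt \<Rightarrow> 'a rule \<Rightarrow> bool" where
  "wf_rule M r \<longleftrightarrow>
     rstate r \<in> states M \<and> rsym r \<in> inp M (rank r) \<and>
     rhs r \<in> trees_over (out M) (state_calls (states M) (rank r)) \<and>
     (\<forall>i<rank r. recognizable (inp M) (look r i))"

definition tdtt_la :: "'a tdtt \<Rightarrow> bool" where
  "tdtt_la M \<longleftrightarrow>
     ranked_alphabet (inp M) \<and> ranked_alphabet (out M) \<and>
     finite (states M) \<and> states M \<inter> (\<Union>k. inp M k \<union> out M k) = {} \<and>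
     initial M \<subseteq> states M \<and>
     finite (rules M) \<and> (\<forall>r\<in>rules M. wf_rule M r)"

inductive step :: "'a tdtt \<Rightarrow> 'a tree \<Rightarrow> 'a tree \<Rightarrow> bool" for M :: "'a tdtt" where
  root: "r \<in> rules M \<Longrightarrow> \<forall>i<rank r. \<phi> i \<in> look r i \<Longrightarrow> step M (subst \<phi> (lhs r)) (subst \<phi> (rhs r))"
| inside: "step M s s' \<Longrightarrow> step M (Node a (us @ s # vs)) (Node a (us @ s' # vs))"

definition realized :: "'a tdtt \<Rightarrow> ('a tree \<times> 'a tree) set" where
  "realized M = {(s, t). s \<in> trees (inp M) \<and> t \<in> trees (out M) \<and>
     (\<exists>q\<in>initial M. (step M)\<^sup>*\<^sup>* (Node q [s]) t)}"

definition linear_tdtt :: "'a tdtt \<Rightarrow> bool" where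
  "linear_tdtt M \<longleftrightarrow> (\<forall>r\<in>rules M. distinct (var_list (rhs r)))"

definition T' :: "'a transformation set" where
  "T' = {(inp M, out M, realized M) | M. tdtt_la M}"

definition LT' :: "'a transformation set" where
  "LT' = {(inp M, out M, realized M) | M. tdtt_la M \<and> linear_tdtt M}"

end

theory Submission
  imports Defs "HOL-Library.FuncSet"
begin

text \<open>
  From left to right, the homomorphism replaces every subtree by \<open>m\<close> copies of itself, where no
  right-hand side has more than \<open>m\<close> variable occurrences; a linear transducer then lets distinct
  occurrences read distinct copies. From right to left, a transducer simulates \<open>N\<close> after \<open>h\<close> by
  running \<open>N\<close> at once on a whole pattern \<open>h\<^sub>k(a)\<close>. This takes finitely many rules since the
  look-ahead of \<open>N\<close> inside the pattern depends only on the states of one finite automaton at the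
  trees substituted for the variables, and these states can be tested by look-ahead on the input.
\<close>

section \<open>Lists of choices, and trees over a ranked alphabet\<close>

lemma in_listset_iff: "ts \<in> listset As \<longleftrightarrow> list_all2 (\<in>) ts As"
  by (induction As arbitrary: ts) (auto simp: set_Cons_def list_all2_Cons2)

lemma finite_listset: "\<forall>A\<in>set As. finite A \<Longrightarrow> finite (listset As)"
proof (induction As)
  case (Cons A As)
  have "set_Cons A (listset As) = (\<lambda>(x, xs). x # xs) ` (A \<times> listset As)"
    by (auto simp: set_Cons_def)
  then show ?case
    using Cons by simp
qed simp

abbreviation calls :: "'a set \<Rightarrow> 'a tree set \<Rightarrow> 'a tree set" where
  "calls Q X \<equiv> {Node q [x] | q x. q \<in> Q \<and> x \<in> X}"

lemma Node_in_trees_iff: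
  "Node a ts \<in> trees \<Sigma> \<longleftrightarrow> a \<in> \<Sigma> (length ts) \<and> set ts \<subseteq> trees \<Sigma>"
  by (auto elim: trees_over.cases intro: trees_over.node)

lemma trees_induct [consumes 1, case_names Node]:
  assumes "t \<in> trees \<Sigma>"
    and "\<And>a ts. a \<in> \<Sigma> (length ts) \<Longrightarrow> set ts \<subseteq> trees \<Sigma> \<Longrightarrow> (\<And>t. t \<in> set ts \<Longrightarrow> P t)
      \<Longrightarrow> P (Node a ts)"
  shows "P t"
  using assms by (induction rule: trees_over.induct) auto

lemma subst_in_trees_over:
  assumes "u \<in> trees_over \<Sigma> X" and "\<And>x. x \<in> X \<Longrightarrow> subst \<sigma> x \<in> trees_over \<Sigma> Y"
  shows "subst \<sigma> u \<in> trees_over \<Sigma> Y"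
  using assms(1) by (induction rule: trees_over.induct) (auto simp: assms(2) intro!: trees_over.node)

section \<open>Big-step semantics\<close>

text \<open>Each occurrence of a call chooses its result from \<open>R q x\<close> independently of
  the others, as copies in a top-down derivation do. The argument \<open>x\<close> stays an
  arbitrary tree, so one function evaluates right-hand sides, sentential forms and symbolic
  results.\<close>

fun expand :: "'a set \<Rightarrow> ('a \<Rightarrow> 'a tree \<Rightarrow> 'a tree set) \<Rightarrow> 'a tree \<Rightarrow> 'a tree set" where
  "expand Q R (Var i) = {}"
| "expand Q R (Node a ws) =
     (if a \<in> Q then case ws of [x] \<Rightarrow> R a x | _ \<Rightarrow> {} else Node a ` listset (map (expand Q R) ws))"

lemma expand_Node_out: "a \<notin> Q \<Longrightarrow>
    t \<in> expand Q R (Node a ws) \<longleftrightarrow> (\<exists>ts. t = Node a ts \<and> list_all2 (\<lambda>t w. t \<in> expand Q R w) ts ws)"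
  by (auto simp: in_listset_iff list.rel_map)

text \<open>\<open>expand\<close> recognizes a call by its root symbol alone, so states must not
  double as output symbols.\<close>

abbreviation disj :: "'a set \<Rightarrow> 'a ranked \<Rightarrow> bool" where
  "disj Q \<Omega> \<equiv> \<forall>k. Q \<inter> \<Omega> k = {}"

lemma expand_cong:
  assumes "w \<in> trees_over \<Omega> (calls Q X)" and "disj Q \<Omega>"
    and "\<And>q x. q \<in> Q \<Longrightarrow> x \<in> X \<Longrightarrow> R q x = R' q x"
  shows "expand Q R w = expand Q R' w"
  using assms(1)
proof (induction rule: trees_over.induct)
  case (node a ts)
  then have "map (expand Q R) ts = map (expand Q R') ts"
    by auto
  moreover have "a \<notin> Q"
    using node(1) assms(2) by auto
  ultimately show ?case
    by (simp only: expand.simps if_False)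
qed (auto simp: assms(3))

text \<open>Output nodes are left alone by a substitution; it changes only the arguments of calls
  and can therefore be moved into \<open>R\<close>.\<close>

lemma expand_subst:
  assumes "w \<in> trees_over \<Omega> (calls Q X)" and "disj Q \<Omega>"
  shows "expand Q R (subst \<sigma> w) = expand Q (\<lambda>q x. R q (subst \<sigma> x)) w"
  using assms(1)
proof (induction rule: trees_over.induct)
  case (node a ts)
  then have "map (expand Q R) (map (subst \<sigma>) ts) = map (expand Q (\<lambda>q x. R q (subst \<sigma> x))) ts"
    by auto
  moreover have "a \<notin> Q"
    using node(1) assms(2) by auto
  ultimately show ?case
    by (simp only: subst.simps expand.simps if_False)
qed auto

lemma expand_trees:
  assumes "t \<in> trees \<Omega>" and "disj Q \<Omega>"
  shows "expand Q R t = {t}"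
  using assms(1)
proof (induction rule: trees_induct)
  case (Node a ts)
  then have "listset (map (expand Q R) ts) = {ts}"
    by (auto simp: in_listset_iff list.rel_map list_all2_conv_all_nth list_eq_iff_nth_eq)
  with Node assms(2) show ?case
    by auto
qed

lemma expand_in_trees_over:
  assumes "w \<in> trees_over \<Omega> (calls Q X)" and "disj Q \<Omega>"
    and "\<And>q x. q \<in> Q \<Longrightarrow> x \<in> X \<Longrightarrow> R q x \<subseteq> trees_over \<Omega> S"
  shows "expand Q R w \<subseteq> trees_over \<Omega> S"
  using assms(1)
proof (induction rule: trees_over.induct)
  case (node a ws)
  show ?case
  proof
    fix t assume "t \<in> expand Q R (Node a ws)"
    then obtain ts where ts: "t = Node a ts" "list_all2 (\<lambda>t w. t \<in> expand Q R w) ts ws"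
      using node(1) assms(2) by (subst (asm) expand_Node_out) auto
    have "list_all2 (\<lambda>t w. t \<in> trees_over \<Omega> S) ts ws"
      using ts(2) by (rule list.rel_mono_strong) (use node(2) in blast)
    then have "\<forall>t\<in>set ts. t \<in> trees_over \<Omega> S" "length ts = length ws"
      by (auto simp: list_all2_conv_all_nth in_set_conv_nth)
    then show "t \<in> trees_over \<Omega> S"
      using node(1) ts(1) by (auto intro: trees_over.node)
  qed
qed (use assms(3) in fastforce)

lemma finite_expand:
  assumes "w \<in> trees_over \<Omega> (calls Q X)" and "disj Q \<Omega>"
    and "\<And>q x. q \<in> Q \<Longrightarrow> x \<in> X \<Longrightarrow> finite (R q x)"
  shows "finite (expand Q R w)"
  using assms(1)
  by (induction rule: trees_over.induct)
    (use assms(2,3) in \<open>auto intro!: finite_imageI finite_listset\<close>)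

text \<open>Choices made in two stages can be nested: the list relator commutes with relational
  composition, which supplies the list of intermediate results for the children.
  \<open>run_subst\<close> uses this to let symbolic results act as right-hand sides.\<close>

lemma expand_UN:
  assumes "w \<in> trees_over \<Omega> (calls Q X)" and "disj Q \<Omega>" and "disj Q' \<Omega>"
  shows "expand Q (\<lambda>q x. \<Union>v\<in>S q x. expand Q' R v) w = (\<Union>v\<in>expand Q S w. expand Q' R v)"
  using assms(1)
proof (induction rule: trees_over.induct)
  case (node a ws)
  let ?E = "expand Q (\<lambda>q x. \<Union>v\<in>S q x. expand Q' R v)"
  have a: "a \<notin> Q" "a \<notin> Q'"
    using node(1) assms by auto
  have IH: "t \<in> ?E w \<longleftrightarrow> (\<exists>v. t \<in> expand Q' R v \<and> v \<in> expand Q S w)" if "w \<in> set ws" for t w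
    using node(2) that by auto
  have "list_all2 (\<lambda>t w. t \<in> ?E w) ts ws \<longleftrightarrow>
      list_all2 (\<lambda>t w. \<exists>v. t \<in> expand Q' R v \<and> v \<in> expand Q S w) ts ws" for ts
    using IH by (auto simp: list_all2_conv_all_nth)
  also have "\<dots> ts \<longleftrightarrow> (\<exists>vs. list_all2 (\<lambda>t v. t \<in> expand Q' R v) ts vs \<and>
      list_all2 (\<lambda>v w. v \<in> expand Q S w) vs ws)" for ts
    using list.rel_compp[of "\<lambda>t v. t \<in> expand Q' R v" "\<lambda>v w. v \<in> expand Q S w"]
    by (auto simp: OO_def fun_eq_iff)
  finally have eq: "list_all2 (\<lambda>t w. t \<in> ?E w) ts ws \<longleftrightarrow>
    (\<exists>vs. list_all2 (\<lambda>t v. t \<in> expand Q' R v) ts vs \<and>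
      list_all2 (\<lambda>v w. v \<in> expand Q S w) vs ws)" for ts .
  show ?case
    unfolding set_eq_iff UN_iff Bex_def expand_Node_out[OF a(1)] eq
    by (auto simp: expand_Node_out[OF a(2)] simp del: expand.simps) blast+
qed auto

text \<open>
  The parameters \<open>ok\<close> and \<open>B\<close> cover both the transducer itself (\<open>ok\<close> is the look-ahead and \<open>B\<close> is
  empty) and symbolic runs on patterns with variables, where \<open>B q i\<close> is the result at variable \<open>i\<close>.
\<close>

function run :: "'a set \<Rightarrow> 'a rule set \<Rightarrow> ('a rule \<Rightarrow> nat \<Rightarrow> 'a tree \<Rightarrow> bool) \<Rightarrow>
    ('a \<Rightarrow> nat \<Rightarrow> 'a tree set) \<Rightarrow> 'a \<Rightarrow> 'a tree \<Rightarrow> 'a tree set" where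
  "run Q Rs ok B q (Var i) = B q i"
| "run Q Rs ok B q (Node a us) =
    (\<Union>r\<in>{r\<in>Rs. rstate r = q \<and> rsym r = a \<and> rank r = length us \<and> (\<forall>i<length us. ok r i (us ! i))}.
      expand Q (\<lambda>p x. case x of Var i \<Rightarrow> if i < length us then run Q Rs ok B p (us ! i) else {}
                              | Node b vs \<Rightarrow> {}) (rhs r))"
  by pat_completeness auto
termination
  by (relation "measure (\<lambda>(Q, Rs, ok, B, q, t). size t)")
    (auto intro!: less_Suc_eq_le[THEN iffD2] size_list_estimation'[OF nth_mem])

lemma tdtt_laD:
  assumes "tdtt_la M"
  shows "disj (states M) (inp M)" "disj (states M) (out M)"
    and "r \<in> rules M \<Longrightarrow> rhs r \<in> trees_over (out M) (calls (states M) (xvars (rank r)))"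
    and "r \<in> rules M \<Longrightarrow> rstate r \<in> states M"
    and "r \<in> rules M \<Longrightarrow> rsym r \<in> inp M (rank r)"
    and "r \<in> rules M \<Longrightarrow> i < rank r \<Longrightarrow> recognizable (inp M) (look r i)"
    and "finite (rules M)"
  using assms by (fastforce simp: tdtt_la_def wf_rule_def state_calls_def)+

abbreviation trun where
  "trun M \<equiv> run (states M) (rules M)"

text \<open>The right-hand side of a rule of rank \<open>length us\<close> calls only variables
  \<open>Var i\<close> with \<open>i < length us\<close>. The guard and the case distinction in
  \<open>run\<close>, which secure termination, thus give way to a substitution.\<close>

lemma run_Node:
  assumes "tdtt_la M"
  shows "trun M ok B q (Node a us) =
    (\<Union>r\<in>{r\<in>rules M. rstate r = q \<and> rsym r = a \<and> rank r = length us \<and> (\<forall>i<length us. ok r i (us ! i))}.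
      expand (states M) (\<lambda>p x. trun M ok B p (subst ((!) us) x)) (rhs r))"
  unfolding run.simps
  by (intro SUP_cong refl expand_cong[OF tdtt_laD(3)[OF assms]])
    (auto simp: xvars_def tdtt_laD(2)[OF assms])

text \<open>The case \<open>k = 0\<close> with empty \<open>B\<close> concerns real runs; with calls
  as values of \<open>B\<close> it shows that symbolic runs yield legal right-hand sides.\<close>

lemma run_in_trees_over:
  assumes "tdtt_la M" and "u \<in> trees_over (inp M) (xvars k)" and "q \<in> states M"
    and B: "\<And>p i. p \<in> states M \<Longrightarrow> i < k \<Longrightarrow> B p i \<subseteq> trees_over (out M) S"
  shows "trun M ok B q u \<subseteq> trees_over (out M) S"
  using assms(2,3)
proof (induction arbitrary: q rule: trees_over.induct)
  case (node a us)
  have "expand (states M) (\<lambda>p x. trun M ok B p (subst ((!) us) x)) (rhs r) \<subseteq> trees_over (out M) S"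
    if "r \<in> rules M" "rank r = length us" for r
  proof (rule expand_in_trees_over[OF tdtt_laD(3,2)[OF assms(1)]])
    show "trun M ok B p (subst ((!) us) x) \<subseteq> trees_over (out M) S"
      if px: "p \<in> states M" "x \<in> xvars (rank r)" for p x
    proof -
      obtain i where i: "x = Var i" "i < length us"
        using px(2) \<open>rank r = length us\<close> by (auto simp: xvars_def)
      then have "us ! i \<in> set us"
        by simp
      then show ?thesis
        using node(2) px(1) i(1) by auto
    qed
  qed fact
  then show ?case
    unfolding run_Node[OF assms(1)] by blast
qed (use B in \<open>fastforce simp: xvars_def\<close>)

text \<open>This makes the rule set of the transducer built in \<open>HOM_comp_in_T'\<close>
  finite.\<close>

lemma finite_run:
  assumes "tdtt_la M" and "u \<in> trees_over (inp M) (xvars k)" and "\<And>p i. finite (B p i)"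
  shows "finite (trun M ok B q u)"
  using assms(2)
proof (induction arbitrary: q rule: trees_over.induct)
  case (node a us)
  have "finite (expand (states M) (\<lambda>p x. trun M ok B p (subst ((!) us) x)) (rhs r))"
    if "r \<in> rules M" "rank r = length us" for r
    using node(2) that
    by (intro finite_expand[OF tdtt_laD(3,2)[OF assms(1)]]) (auto simp: xvars_def)
  then show ?case
    unfolding run_Node[OF assms(1)] using tdtt_laD(7)[OF assms(1)] by auto
qed (auto simp: xvars_def assms(3))

abbreviation tr :: "'a tdtt \<Rightarrow> 'a \<Rightarrow> 'a tree \<Rightarrow> 'a tree set" where
  "tr M \<equiv> trun M (\<lambda>r i s. s \<in> look r i) (\<lambda>q i. {})"

lemma tr_in_trees:
  assumes "tdtt_la M" and "s \<in> trees (inp M)" and "q \<in> states M"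
  shows "tr M q s \<subseteq> trees (out M)"
  by (rule run_in_trees_over[where k = 0]) (use assms in \<open>auto simp: xvars_def\<close>)

text \<open>The same rules apply at a node of the pattern and at its instance, since
  \<open>ok\<close> predicts the look-ahead; then \<open>expand_UN\<close> pulls the second stage,
  given by \<open>Q'\<close> and \<open>R\<close>, out of the right-hand side. At a variable the
  claim is the assumption on \<open>B\<close>. A run on an instance thus splits into a symbolic run
  on the pattern and runs on the substituted trees.\<close>

lemma run_subst:
  assumes "tdtt_la M" and "disj Q' (out M)" and "u \<in> trees_over (inp M) (xvars k)"
    and ok: "\<And>r i v. r \<in> rules M \<Longrightarrow> i < rank r \<Longrightarrow> v \<in> trees_over (inp M) (xvars k)
      \<Longrightarrow> ok r i v \<longleftrightarrow> subst \<eta> v \<in> look r i"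
    and B: "\<And>q i. q \<in> states M \<Longrightarrow> i < k \<Longrightarrow> tr M q (\<eta> i) = (\<Union>w\<in>B q i. expand Q' R w)"
    and "q \<in> states M"
  shows "tr M q (subst \<eta> u) = (\<Union>w\<in>trun M ok B q u. expand Q' R w)"
  using assms(3,6)
proof (induction arbitrary: q rule: trees_over.induct)
  case (node a us)
  let ?us = "map (subst \<eta>) us"
  have eq: "expand (states M) (\<lambda>p x. tr M p (subst ((!) ?us) x)) (rhs r) =
      (\<Union>w\<in>expand (states M) (\<lambda>p x. trun M ok B p (subst ((!) us) x)) (rhs r). expand Q' R w)"
    if r: "r \<in> rules M" "rank r = length us" for r
  proof -
    note rhs = tdtt_laD(3)[OF assms(1) r(1)] and disj = tdtt_laD(2)[OF assms(1)]
    have "expand (states M) (\<lambda>p x. tr M p (subst ((!) ?us) x)) (rhs r) =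
        expand (states M) (\<lambda>p x. \<Union>w\<in>trun M ok B p (subst ((!) us) x). expand Q' R w) (rhs r)"
    proof (rule expand_cong[OF rhs disj])
      fix p and x :: "'a tree" assume px: "p \<in> states M" "x \<in> xvars (rank r)"
      then obtain i where i: "x = Var i" "i < length us"
        using r(2) by (auto simp: xvars_def)
      then have "us ! i \<in> set us"
        by simp
      then show "tr M p (subst ((!) ?us) x) =
          (\<Union>w\<in>trun M ok B p (subst ((!) us) x). expand Q' R w)"
        using node(2) px(1) i by simp
    qed
    also note expand_UN[OF rhs disj assms(2)]
    finally show ?thesis .
  qed
  have idx: "{r\<in>rules M. rstate r = q \<and> rsym r = a \<and> rank r = length ?us \<and>
        (\<forall>i<length ?us. ?us ! i \<in> look r i)} =
      {r\<in>rules M. rstate r = q \<and> rsym r = a \<and> rank r = length us \<and> (\<forall>i<length us. ok r i (us ! i))}"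
  proof -
    have "?us ! i \<in> look r i \<longleftrightarrow> ok r i (us ! i)"
      if "r \<in> rules M" "rank r = length us" "i < length us" for r i
    proof -
      have "us ! i \<in> trees_over (inp M) (xvars k)"
        using node(2) that(3) nth_mem by blast
      then show ?thesis
        using ok[of r i "us ! i"] that by simp
    qed
    then show ?thesis
      by auto
  qed
  show ?case
    unfolding subst.simps run_Node[OF assms(1)] idx UN_UN_flatten
    by (rule SUP_cong) (auto simp: eq)
qed (use B in \<open>auto simp: xvars_def\<close>)

section \<open>Big steps and rewriting\<close>

text \<open>Every left-hand side has a state at its root, and no state is an input symbol. Hence a
  call on an input tree can be rewritten only at its root.\<close>

lemma no_step_trees:
  assumes "tdtt_la M" and "step M s s'"
  shows "s \<notin> trees (inp M)"
  using assms(2)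
proof induction
  case (root r \<phi>)
  then show ?case
    using tdtt_laD(1,4)[OF assms(1)] by (fastforce simp: lhs_def Node_in_trees_iff)
qed (auto simp: Node_in_trees_iff)

text \<open>The children are rewritten from left to right; the prefix \<open>us\<close> collects
  those already finished.\<close>

lemma steps_Node:
  assumes "list_all2 (step M)\<^sup>*\<^sup>* ws ts"
  shows "(step M)\<^sup>*\<^sup>* (Node a (us @ ws)) (Node a (us @ ts))"
  using assms
proof (induction arbitrary: us rule: list_all2_induct)
  case (Cons w ws t ts)
  have "(step M)\<^sup>*\<^sup>* (Node a (us @ w # ws)) (Node a (us @ t # ws))"
    using Cons(1) by induction (auto intro: rtranclp.rtrancl_into_rtrancl step.inside)
  also have "(step M)\<^sup>*\<^sup>* \<dots> (Node a (us @ t # ts))"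
    using Cons(3)[of "us @ [t]"] by simp
  finally show ?case .
qed simp

lemma expand_imp_steps:
  assumes "w \<in> trees_over \<Omega> (calls Q X)" and "disj Q \<Omega>"
    and "\<And>q s t. q \<in> Q \<Longrightarrow> s \<in> X \<Longrightarrow> t \<in> R q s \<Longrightarrow> (step M)\<^sup>*\<^sup>* (Node q [s]) t"
    and "t \<in> expand Q R w"
  shows "(step M)\<^sup>*\<^sup>* w t"
  using assms(1,4)
proof (induction arbitrary: t rule: trees_over.induct)
  case (node a ws)
  have "a \<notin> Q"
    using node(1) assms(2) by auto
  then obtain ts where ts: "t = Node a ts" "list_all2 (\<lambda>t w. t \<in> expand Q R w) ts ws"
    using node(3) expand_Node_out by metis
  have "list_all2 (step M)\<^sup>*\<^sup>* ws ts"
    using ts(2) node(2) by (auto simp: list_all2_conv_all_nth)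
  then show ?case
    using steps_Node[of M ws ts a "[]"] ts by simp
qed (use assms(3) in auto)

lemma subst_rhs_in_trees_over:
  assumes "tdtt_la M" and "r \<in> rules M" and "\<forall>i<rank r. \<phi> i \<in> trees (inp M)"
  shows "subst \<phi> (rhs r) \<in> trees_over (out M) (calls (states M) (trees (inp M)))"
proof (rule subst_in_trees_over[OF tdtt_laD(3)[OF assms(1,2)]])
  fix x assume "x \<in> calls (states M) (xvars (rank r))"
  then show "subst \<phi> x \<in> trees_over (out M) (calls (states M) (trees (inp M)))"
    using assms(3) by (intro trees_over.base) (auto simp: xvars_def)
qed

lemma tr_imp_steps:
  assumes "tdtt_la M" and "s \<in> trees (inp M)" and "t \<in> tr M q s"
  shows "(step M)\<^sup>*\<^sup>* (Node q [s]) t"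
  using assms(2,3)
proof (induction arbitrary: q t rule: trees_induct)
  case (Node a ss)
  then obtain r where r: "r \<in> rules M" "rstate r = q" "rsym r = a" "rank r = length ss"
      "\<forall>i<length ss. ss ! i \<in> look r i"
    and t: "t \<in> expand (states M) (\<lambda>p x. tr M p (subst ((!) ss) x)) (rhs r)"
    unfolding run_Node[OF assms(1)] by blast
  have rhs: "rhs r \<in> trees_over (out M) (calls (states M) (xvars (rank r)))"
    by (rule tdtt_laD(3)[OF assms(1) r(1)])
  \<comment> \<open>With the direct subtrees as the only call arguments, the induction hypothesis
    supplies what \<open>expand_imp_steps\<close> asks of the calls.\<close>
  have sub: "subst ((!) ss) (rhs r) \<in> trees_over (out M) (calls (states M) (set ss))"
    using r(4) by (intro subst_in_trees_over[OF rhs])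
      (auto simp: xvars_def intro!: trees_over.base)
  have "t \<in> expand (states M) (tr M) (subst ((!) ss) (rhs r))"
    using t by (simp add: expand_subst[OF rhs tdtt_laD(2)[OF assms(1)]])
  then have "(step M)\<^sup>*\<^sup>* (subst ((!) ss) (rhs r)) t"
    by (rule expand_imp_steps[OF sub tdtt_laD(2)[OF assms(1)], rotated]) (auto intro: Node.IH)
  moreover have "step M (Node q [Node a ss]) (subst ((!) ss) (rhs r))"
  proof -
    have "subst ((!) ss) (lhs r) = Node q [Node a ss]"
      using r by (simp add: lhs_def map_nth comp_def)
    then show ?thesis
      using step.root[of r M "(!) ss"] r by simp
  qed
  ultimately show ?case
    by simp
qed

text \<open>A step commits one call to one applicable rule, and so can only lose results. The redex
  is always a whole call: output symbols are not states, and input trees admit no step.\<close>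

lemma step_sentential:
  assumes "tdtt_la M" and "w \<in> trees_over (out M) (calls (states M) (trees (inp M)))"
    and "step M w w'"
  shows "w' \<in> trees_over (out M) (calls (states M) (trees (inp M)))
    \<and> expand (states M) (tr M) w' \<subseteq> expand (states M) (tr M) w"
  using assms(2,3)
proof (induction arbitrary: w' rule: trees_over.induct)
  case (base w)
  then obtain q s where w: "w = Node q [s]" "q \<in> states M" "s \<in> trees (inp M)"
    by auto
  from base(2) show ?case
  proof cases
    case (root r \<phi>)
    let ?ss = "map \<phi> [0..<rank r]"
    have q: "q = rstate r" and s: "s = Node (rsym r) ?ss"
      using root(1) w(1) by (auto simp: lhs_def)
    have in_trees: "\<forall>i<rank r. \<phi> i \<in> trees (inp M)"
      using w(3) by (auto simp: s Node_in_trees_iff)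
    have rhs: "rhs r \<in> trees_over (out M) (calls (states M) (xvars (rank r)))"
      by (rule tdtt_laD(3)[OF assms(1) root(3)])
    have "expand (states M) (tr M) w' = expand (states M) (\<lambda>p x. tr M p (subst \<phi> x)) (rhs r)"
      unfolding root(2) by (rule expand_subst[OF rhs tdtt_laD(2)[OF assms(1)]])
    \<comment> \<open>\<open>\<phi>\<close> and \<open>?ss\<close> need agree only below the rank,
      because the right-hand side calls no other variable.\<close>
    also have "\<dots> = expand (states M) (\<lambda>p x. tr M p (subst ((!) ?ss) x)) (rhs r)"
      by (intro expand_cong[OF rhs tdtt_laD(2)[OF assms(1)]]) (auto simp: xvars_def)
    also have "\<dots> \<subseteq> tr M q s"
      unfolding run_Node[OF assms(1)] s q using root(3,4)
      by (intro UN_upper) auto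
    finally show ?thesis
      using subst_rhs_in_trees_over[OF assms(1) root(3) in_trees] root(2) w by simp
  next
    case (inside s0 s1 _ us vs)
    then have "step M s s1"
      using w(1) by (auto simp: append_eq_Cons_conv Cons_eq_append_conv)
    then show ?thesis
      using no_step_trees[OF assms(1)] w(3) by blast
  qed
next
  case (node a ws)
  have a: "a \<notin> states M"
    using node(1) tdtt_laD(2)[OF assms(1)] by auto
  from node(3) show ?case
  proof cases
    case (root r \<phi>)
    then show ?thesis
      using a tdtt_laD(4)[OF assms(1)] by (auto simp: lhs_def)
  next
    case (inside s s' us vs)
    note eq = inside(1)
    have IH: "s' \<in> trees_over (out M) (calls (states M) (trees (inp M)))"
      "expand (states M) (tr M) s' \<subseteq> expand (states M) (tr M) s"
      using node(2) eq inside(3) by auto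
    have "list_all2 (\<lambda>t w. t \<in> expand (states M) (tr M) w) ts (us @ s # vs)"
      if ts: "list_all2 (\<lambda>t w. t \<in> expand (states M) (tr M) w) ts (us @ s' # vs)" for ts
    proof -
      from ts obtain ts1 t ts2 where "ts = ts1 @ t # ts2" "t \<in> expand (states M) (tr M) s'"
        "list_all2 (\<lambda>t w. t \<in> expand (states M) (tr M) w) ts1 us"
        "list_all2 (\<lambda>t w. t \<in> expand (states M) (tr M) w) ts2 vs"
        by (auto simp: list_all2_append2 list_all2_Cons2)
      then show ?thesis
        using IH(2) by (auto intro!: list_all2_appendI)
    qed
    then have "expand (states M) (tr M) w' \<subseteq> expand (states M) (tr M) (Node a ws)"
      unfolding inside(2) eq by (auto simp: expand_Node_out[OF a] simp del: expand.simps)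
    moreover have "w' \<in> trees_over (out M) (calls (states M) (trees (inp M)))"
      unfolding inside(2) using node(1,2) IH(1) eq by (intro trees_over.node) auto
    ultimately show ?thesis
      by (rule conjI[rotated])
  qed
qed

text \<open>The final tree expands only to itself. Going back along the derivation, the set of
  results can only grow by \<open>step_sentential\<close>, so \<open>t\<close> is still among the
  results of the initial call.\<close>

lemma steps_imp_tr:
  assumes "tdtt_la M" and "s \<in> trees (inp M)" and "q \<in> states M" and "t \<in> trees (out M)"
    and "(step M)\<^sup>*\<^sup>* (Node q [s]) t"
  shows "t \<in> tr M q s"
proof -
  have "w \<in> trees_over (out M) (calls (states M) (trees (inp M)))
    \<Longrightarrow> t \<in> expand (states M) (tr M) w" if "(step M)\<^sup>*\<^sup>* w t" for w
    using that
  proof (induction rule: converse_rtranclp_induct)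
    case base
    show ?case
      using expand_trees[OF assms(4) tdtt_laD(2)[OF assms(1)]] by simp
  next
    case (step w w')
    then show ?case
      using step_sentential[OF assms(1) step.prems step.hyps(1)] by blast
  qed
  from this[OF assms(5)] show ?thesis
    using assms(2,3) by (simp add: trees_over.base)
qed

text \<open>From here on the arguments work with \<open>tr\<close> alone, and rewriting no longer
  appears.\<close>

lemma realized_eq:
  assumes "tdtt_la M"
  shows "realized M = {(s, t). s \<in> trees (inp M) \<and> (\<exists>q\<in>initial M. t \<in> tr M q s)}"
proof -
  have "initial M \<subseteq> states M"
    using assms by (simp add: tdtt_la_def)
  then show ?thesis
    unfolding realized_def
    using tr_imp_steps[OF assms] steps_imp_tr[OF assms] tr_in_trees[OF assms] by blast
qed

section \<open>Copying the subtrees\<close>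

text \<open>The symbols keep their names, so the states stay disjoint from them; only the rank grows
  from \<open>k\<close> to \<open>k * m\<close>, and for positive \<open>m\<close> division recovers
  \<open>k\<close>.\<close>

definition copy_alphabet :: "nat \<Rightarrow> 'a ranked \<Rightarrow> 'a ranked" where
  "copy_alphabet m \<Sigma> n = (if m dvd n then \<Sigma> (n div m) else {})"

text \<open>Position \<open>j\<close> is meant as copy \<open>j mod m\<close> of subtree
  \<open>j div m\<close>.\<close>

definition copy_hom :: "nat \<Rightarrow> nat \<Rightarrow> 'a \<Rightarrow> 'a tree" where
  "copy_hom m k a = Node a (map (\<lambda>j. Var (j div m)) [0..<k * m])"

lemma copy_hom_Node:
  "hom_ext (copy_hom m) (Node a ss) =
    Node a (map (\<lambda>j. hom_ext (copy_hom m) (ss ! (j div m))) [0..<length ss * m])"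
  by (auto simp: copy_hom_def less_mult_imp_div_less)

lemma ranked_alphabet_copy:
  assumes "ranked_alphabet \<Sigma>" and "m > 0"
  shows "ranked_alphabet (copy_alphabet m \<Sigma>)"
proof -
  have "{n. copy_alphabet m \<Sigma> n \<noteq> {}} \<subseteq> (\<lambda>k. k * m) ` {k. \<Sigma> k \<noteq> {}}"
    by (force simp: copy_alphabet_def split: if_splits)
  then have "finite {n. copy_alphabet m \<Sigma> n \<noteq> {}}"
    by (rule finite_subset) (use assms(1) in \<open>simp add: ranked_alphabet_def\<close>)
  moreover have "finite (copy_alphabet m \<Sigma> n)" for n
    using assms(1) by (simp add: ranked_alphabet_def copy_alphabet_def)
  ultimately show ?thesis
    by (simp add: ranked_alphabet_def)
qed

lemma copy_in_trees:
  assumes "s \<in> trees \<Sigma>" and "m > 0"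
  shows "hom_ext (copy_hom m) s \<in> trees (copy_alphabet m \<Sigma>)"
  using assms(1)
  by (induction rule: trees_induct)
    (use assms(2) in \<open>auto simp: copy_hom_Node Node_in_trees_iff copy_alphabet_def
      less_mult_imp_div_less simp del: hom_ext.simps\<close>)

text \<open>All copies of a subtree get the same automaton state, so it suffices to read the first
  copy in each block, at position \<open>i * m\<close>. Only images under the homomorphism matter;
  the behaviour of \<open>L'\<close> on other trees is left open.\<close>

lemma recognizable_copy:
  assumes "recognizable \<Sigma> L" and "m > 0"
  shows "\<exists>L'. recognizable (copy_alphabet m \<Sigma>) L' \<and>
    (\<forall>s\<in>trees \<Sigma>. hom_ext (copy_hom m) s \<in> L' \<longleftrightarrow> s \<in> L)"
proof -
  obtain Q F \<delta> where Q: "finite Q" "F \<subseteq> Q"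
      "\<forall>k. \<forall>a\<in>\<Sigma> k. \<forall>ps. length ps = k \<and> set ps \<subseteq> Q \<longrightarrow> \<delta> a ps \<in> Q"
    and L: "L = {t \<in> trees \<Sigma>. dhat \<delta> t \<in> F}"
    using assms(1) unfolding recognizable_def by (elim exE conjE) (rule that)
  define \<delta>' where "\<delta>' a ps = \<delta> a (map (\<lambda>i. ps ! (i * m)) [0..<length ps div m])" for a ps
  have "\<delta>' a ps \<in> Q" if "a \<in> copy_alphabet m \<Sigma> (length ps)" "set ps \<subseteq> Q" for a ps
  proof -
    from that(1) have "a \<in> \<Sigma> (length ps div m)" "m dvd length ps"
      by (auto simp: copy_alphabet_def split: if_splits)
    moreover have "ps ! (i * m) \<in> Q" if "i < length ps div m" for i
    proof -
      have "i * m < length ps"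
        using that \<open>m dvd length ps\<close> \<open>m > 0\<close> by (auto elim!: dvdE)
      then show ?thesis
        using \<open>set ps \<subseteq> Q\<close> by auto
    qed
    ultimately show ?thesis
      unfolding \<delta>'_def by (intro Q(3)[rule_format]) auto
  qed
  then have "recognizable (copy_alphabet m \<Sigma>) {t \<in> trees (copy_alphabet m \<Sigma>). dhat \<delta>' t \<in> F}"
    unfolding recognizable_def using Q(1,2) by (intro exI[of _ Q] exI[of _ F] exI[of _ \<delta>']) auto
  moreover have dhat: "dhat \<delta>' (hom_ext (copy_hom m) s) = dhat \<delta> s" if "s \<in> trees \<Sigma>" for s
    using that
  proof (induction rule: trees_induct)
    case (Node a ss)
    have "map (\<lambda>i. map (dhat \<delta>' \<circ> (\<lambda>j. hom_ext (copy_hom m) (ss ! (j div m)))) [0..<length ss * m]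
        ! (i * m)) [0..<length ss] = map (dhat \<delta>) ss"
      using Node(3) assms(2) by (intro nth_equalityI) auto
    then show ?case
      using assms(2) by (simp add: copy_hom_Node \<delta>'_def[of a] del: hom_ext.simps)
  qed
  ultimately show ?thesis
    using copy_in_trees[OF _ assms(2)]
    by (intro exI[of _ "{t \<in> trees (copy_alphabet m \<Sigma>). dhat \<delta>' t \<in> F}"]) (auto simp: L)
qed

text \<open>The variable occurrences are numbered from left to right; occurrence \<open>p\<close> of the right-hand
  side reads copy \<open>p\<close> of its subtree.\<close>

lemma linearize:
  assumes "w \<in> trees_over \<Omega> (calls Q (xvars k))" and "n + length (var_list w) \<le> m"
  shows "\<exists>w'\<in>trees_over \<Omega> (calls Q (xvars (k * m))). subst (\<lambda>j. Var (j div m)) w' = w \<and>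
    map (\<lambda>j. j mod m) (var_list w') = [n..<n + length (var_list w)]"
  using assms
proof (induction arbitrary: n rule: trees_over.induct)
  case (base w)
  then obtain q i where w: "w = Node q [Var i]" "q \<in> Q" "i < k"
    by (auto simp: xvars_def)
  then have n: "n < m"
    using base(2) by simp
  \<comment> \<open>Occurrence number \<open>n\<close> takes copy \<open>n\<close> in block
    \<open>i\<close>: the index \<open>i * m + n\<close> has quotient \<open>i\<close> and remainder
    \<open>n\<close>, as \<open>n < m\<close>.\<close>
  have "i * m + n < Suc i * m"
    using n by simp
  also have "\<dots> \<le> k * m"
    using w(3) by (intro mult_right_mono) auto
  finally have "Node q [Var (i * m + n)] \<in> trees_over \<Omega> (calls Q (xvars (k * m)))"
    using w(2) by (intro trees_over.base) (auto simp: xvars_def)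
  then show ?case
    using w n by (intro bexI[of _ "Node q [Var (i * m + n)]"]) auto
next
  case (node a ws)
  let ?T = "trees_over \<Omega> (calls Q (xvars (k * m)))" and ?s = "subst (\<lambda>j. Var (j div m))"
  have "\<exists>ws'. set ws' \<subseteq> ?T \<and> map ?s ws' = ws \<and>
      map (\<lambda>j. j mod m) (concat (map var_list ws')) = [n..<n + length (concat (map var_list ws))]"
    using node(2,3) unfolding var_list.simps
  proof (induction ws arbitrary: n)
    case (Cons w ws)
    let ?n = "n + length (var_list w)"
    obtain w' where w': "w' \<in> ?T" "?s w' = w" "map (\<lambda>j. j mod m) (var_list w') = [n..<?n]"
      using Cons(2,3) by force
    obtain ws' where ws': "set ws' \<subseteq> ?T" "map ?s ws' = ws"
      "map (\<lambda>j. j mod m) (concat (map var_list ws')) = [?n..<?n + length (concat (map var_list ws))]"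
      using Cons(1)[of ?n] Cons(2,3) by (auto simp: add.assoc)
    show ?case
      using w' ws' upt_add_eq_append[of n ?n "length (concat (map var_list ws))"]
      by (intro exI[of _ "w' # ws'"]) (simp add: add.assoc)
  qed simp
  then obtain ws' where ws': "set ws' \<subseteq> ?T" "map ?s ws' = ws"
      "map (\<lambda>j. j mod m) (concat (map var_list ws')) = [n..<n + length (concat (map var_list ws))]"
    by blast
  then have "length ws' = length ws"
    by auto
  then show ?case
    using ws' node(1) by (intro bexI[of _ "Node a ws'"]) (auto intro: trees_over.node)
qed

lemma HOM_I:
  assumes "ranked_alphabet \<Sigma>" and "ranked_alphabet \<Delta>"
    and "\<And>k a. a \<in> \<Sigma> k \<Longrightarrow> h k a \<in> trees_over \<Delta> (xvars k)"
  shows "(\<Sigma>, \<Delta>, {(t, hom_ext h t) | t. t \<in> trees \<Sigma>}) \<in> HOM"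
  using assms unfolding HOM_def by blast

lemma class_compI:
  "(\<Sigma>, \<Delta>, M\<^sub>1) \<in> F \<Longrightarrow> (\<Delta>, \<Omega>, M\<^sub>2) \<in> G \<Longrightarrow> (\<Sigma>, \<Omega>, M\<^sub>1 O M\<^sub>2) \<in> F \<odot> G"
  unfolding class_comp_def by blast

lemma T'_subset:
  assumes M: "tdtt_la M"
  shows "(inp M, out M, realized M) \<in> HOM \<odot> LT'"
proof -
  obtain m0 where m0: "\<forall>n\<in>(\<lambda>r. length (var_list (rhs r))) ` rules M. n \<le> m0"
    using finite_nat_set_iff_bounded_le tdtt_laD(7)[OF M] finite_imageI by metis
  \<comment> \<open>The successor keeps \<open>m\<close> positive even if no right-hand side
    contains a variable; with \<open>m = 0\<close> the homomorphism would erase all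
    subtrees.\<close>
  define m where "m = Suc m0"
  have m: "m > 0" "\<And>r. r \<in> rules M \<Longrightarrow> length (var_list (rhs r)) \<le> m"
    using m0 by (auto simp: m_def intro: le_SucI)
  let ?h = "hom_ext (copy_hom m)" and ?\<Gamma> = "copy_alphabet m (inp M)"
  have "\<exists>w'. w' \<in> trees_over (out M) (calls (states M) (xvars (rank r * m))) \<and>
      subst (\<lambda>j. Var (j div m)) w' = rhs r \<and> distinct (var_list w')" if r: "r \<in> rules M" for r
  proof -
    obtain w' where w': "w' \<in> trees_over (out M) (calls (states M) (xvars (rank r * m)))"
      "subst (\<lambda>j. Var (j div m)) w' = rhs r"
      "map (\<lambda>j. j mod m) (var_list w') = [0..<0 + length (var_list (rhs r))]"
      using linearize[OF tdtt_laD(3)[OF M r], of 0 m] m(2)[OF r] by auto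
    \<comment> \<open>The remainders modulo \<open>m\<close> are already pairwise different, hence
      so are the variables.\<close>
    have "distinct (map (\<lambda>j. j mod m) (var_list w'))"
      unfolding w'(3) by (rule distinct_upt)
    then show ?thesis
      using w'(1,2) by (auto simp: distinct_map)
  qed
  then have "\<forall>r\<in>rules M. \<exists>w'. w' \<in> trees_over (out M) (calls (states M) (xvars (rank r * m))) \<and>
      subst (\<lambda>j. Var (j div m)) w' = rhs r \<and> distinct (var_list w')" ..
  from bchoice[OF this] obtain W where W: "\<And>r. r \<in> rules M \<Longrightarrow>
        W r \<in> trees_over (out M) (calls (states M) (xvars (rank r * m)))"
      "\<And>r. r \<in> rules M \<Longrightarrow> subst (\<lambda>j. Var (j div m)) (W r) = rhs r"
      "\<And>r. r \<in> rules M \<Longrightarrow> distinct (var_list (W r))"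
    by auto
  have "\<forall>L\<in>{L. recognizable (inp M) L}. \<exists>L'. recognizable ?\<Gamma> L' \<and>
      (\<forall>s\<in>trees (inp M). ?h s \<in> L' \<longleftrightarrow> s \<in> L)"
    by (intro ballI recognizable_copy m(1)) simp
  from bchoice[OF this] obtain K where K: "\<And>L. recognizable (inp M) L \<Longrightarrow> recognizable ?\<Gamma> (K L)"
      "\<And>L s. recognizable (inp M) L \<Longrightarrow> s \<in> trees (inp M) \<Longrightarrow> ?h s \<in> K L \<longleftrightarrow> s \<in> L"
    by auto
  \<comment> \<open>Variable \<open>j\<close> stands for a copy of subtree \<open>j div m\<close>
    and inherits the look-ahead of that subtree, translated by \<open>K\<close>.\<close>
  define lin where "lin r = \<lparr>rstate = rstate r, rsym = rsym r, rank = rank r * m, rhs = W r,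
      look = \<lambda>j. K (look r (j div m))\<rparr>" for r
  define N where "N = \<lparr>states = states M, inp = ?\<Gamma>, out = out M, rules = lin ` rules M,
      initial = initial M\<rparr>"
  have N: "tdtt_la N"
  proof -
    have "wf_rule N (lin r)" if "r \<in> rules M" for r
      using that W(1) K(1) tdtt_laD[OF M] m(1)
      by (auto simp: wf_rule_def N_def lin_def copy_alphabet_def state_calls_def
          less_mult_imp_div_less)
    moreover have "states M \<inter> (\<Union>k. ?\<Gamma> k \<union> out M k) = {}"
    proof -
      have "(\<Union>k. ?\<Gamma> k) \<subseteq> (\<Union>k. inp M k)"
        by (auto simp: copy_alphabet_def)
      moreover have "states M \<inter> (\<Union>k. inp M k) = {}" "states M \<inter> (\<Union>k. out M k) = {}"
        using tdtt_laD(1,2)[OF M] by blast+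
      ultimately show ?thesis
        by blast
    qed
    ultimately show ?thesis
      using M ranked_alphabet_copy[OF _ m(1)] by (auto simp: tdtt_la_def N_def)
  qed
  have "linear_tdtt N"
    using W(3) by (auto simp: linear_tdtt_def N_def lin_def)
  have tr_eq: "tr N q (?h s) = tr M q s" if "s \<in> trees (inp M)" for q s
    using that
  proof (induction arbitrary: q rule: trees_induct)
    case (Node a ss)
    let ?us = "map (\<lambda>j. ?h (ss ! (j div m))) [0..<length ss * m]"
    let ?I = "{r\<in>rules M. rstate r = q \<and> rsym r = a \<and> rank r = length ss \<and>
        (\<forall>i<length ss. ss ! i \<in> look r i)}"
    \<comment> \<open>Every subtree index \<open>i\<close> equals \<open>j div m\<close> for the
      position \<open>j = i * m\<close>, so testing all copies tests exactly all subtrees.\<close>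
    have look_iff: "(\<forall>j<length ss * m. ?h (ss ! (j div m)) \<in> K (look r (j div m))) \<longleftrightarrow>
        (\<forall>i<length ss. ss ! i \<in> look r i)" if "r \<in> rules M" "rank r = length ss" for r
    proof -
      have "?h (ss ! i) \<in> K (look r i) \<longleftrightarrow> ss ! i \<in> look r i" if "i < length ss" for i
        using that \<open>r \<in> rules M\<close> \<open>rank r = length ss\<close> Node(2)
        by (intro K(2) tdtt_laD(6)[OF M]) auto
      then show ?thesis
        using m(1) by (metis less_mult_imp_div_less mult_less_cancel2 nonzero_mult_div_cancel_right
            not_less_zero)
    qed
    have "{r\<in>rules N. rstate r = q \<and> rsym r = a \<and> rank r = length ?us \<and>
        (\<forall>i<length ?us. ?us ! i \<in> look r i)} =
      lin ` {r\<in>rules M. rstate r = q \<and> rsym r = a \<and> rank r = length ss \<and>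
        (\<forall>j<length ss * m. ?h (ss ! (j div m)) \<in> K (look r (j div m)))}"
      using m(1) by (auto simp: N_def lin_def)
    also have "\<dots> = lin ` ?I"
      using look_iff by (intro arg_cong[where f = "image lin"] Collect_cong) blast
    finally have "tr N q (?h (Node a ss)) =
        (\<Union>r\<in>?I. expand (states N) (\<lambda>p x. tr N p (subst ((!) ?us) x)) (rhs (lin r)))"
      unfolding copy_hom_Node run_Node[OF N] by simp
    also have "\<dots> = (\<Union>r\<in>?I. expand (states M) (\<lambda>p x. tr M p (subst ((!) ss) x)) (rhs r))"
    proof (rule SUP_cong[OF refl])
      fix r assume "r \<in> ?I"
      then have r: "r \<in> rules M" "rank r = length ss"
        by auto
      have "expand (states N) (\<lambda>p x. tr N p (subst ((!) ?us) x)) (rhs (lin r)) =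
          expand (states M) (\<lambda>p x. tr N p (subst ((!) ?us) x)) (W r)"
        by (simp add: N_def lin_def)
      also have "\<dots> = expand (states M)
          (\<lambda>p x. tr M p (subst ((!) ss) (subst (\<lambda>j. Var (j div m)) x))) (W r)"
        using Node(3) r(2)
        by (intro expand_cong[OF W(1)[OF r(1)] tdtt_laD(2)[OF M]])
          (auto simp: xvars_def less_mult_imp_div_less)
      \<comment> \<open>Identifying the copies turns \<open>W r\<close> back into the original
        right-hand side.\<close>
      also have "\<dots> = expand (states M) (\<lambda>p x. tr M p (subst ((!) ss) x)) (rhs r)"
        unfolding W(2)[OF r(1), symmetric]
        by (rule expand_subst[OF W(1)[OF r(1)] tdtt_laD(2)[OF M], symmetric])
      finally show "expand (states N) (\<lambda>p x. tr N p (subst ((!) ?us) x)) (rhs (lin r)) =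
          expand (states M) (\<lambda>p x. tr M p (subst ((!) ss) x)) (rhs r)" .
    qed
    also have "\<dots> = tr M q (Node a ss)"
      by (rule run_Node[OF M, symmetric])
    finally show ?case .
  qed
  have "copy_hom m k a \<in> trees_over ?\<Gamma> (xvars k)" if "a \<in> inp M k" for k a
    using that m(1) unfolding copy_hom_def
    by (intro trees_over.node)
      (auto simp: copy_alphabet_def xvars_def less_mult_imp_div_less intro!: trees_over.base)
  then have "(inp M, ?\<Gamma>, {(t, ?h t) | t. t \<in> trees (inp M)}) \<in> HOM"
    using M ranked_alphabet_copy[OF _ m(1)] by (intro HOM_I) (auto simp: tdtt_la_def)
  moreover have "(?\<Gamma>, out M, realized N) \<in> LT'"
    unfolding LT'_def mem_Collect_eq using N \<open>linear_tdtt N\<close>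
    by (intro exI[of _ N]) (simp add: N_def)
  moreover have "realized M = {(t, ?h t) | t. t \<in> trees (inp M)} O realized N"
    unfolding realized_eq[OF M] realized_eq[OF N]
    using tr_eq copy_in_trees[OF _ m(1)] by (fastforce simp: N_def)
  ultimately show ?thesis
    by (simp add: class_compI)
qed

section \<open>Composing with a homomorphism\<close>

text \<open>The values of \<open>f\<close> on trees form a finite algebra and serve as automaton
  states; the injection \<open>e\<close> only codes them as natural numbers, and \<open>d\<close>
  decodes them.\<close>

lemma recognizable_compositional:
  fixes f :: "'a tree \<Rightarrow> 'b"
  assumes fin: "finite (f ` trees \<Sigma>)"
    and comp: "\<And>a ts. Node a ts \<in> trees \<Sigma> \<Longrightarrow> f (Node a ts) = \<delta> a (map f ts)"
  shows "recognizable \<Sigma> {t \<in> trees \<Sigma>. P (f t)}"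
proof -
  obtain e :: "_ \<Rightarrow> nat" where e: "inj_on e (f ` trees \<Sigma>)"
    using finite_imp_inj_to_nat_seg[OF fin] by metis
  define d where "d = inv_into (f ` trees \<Sigma>) e"
  have d: "d (e (f t)) = f t" if "t \<in> trees \<Sigma>" for t
    unfolding d_def using e that by simp
  define \<delta>' where "\<delta>' a ns = e (\<delta> a (map d ns))" for a ns
  have dhat: "dhat \<delta>' t = e (f t)" if "t \<in> trees \<Sigma>" for t
    using that
  proof (induction rule: trees_induct)
    case (Node a ts)
    then have "map d (map (dhat \<delta>') ts) = map f ts"
      using d by auto
    moreover have "Node a ts \<in> trees \<Sigma>"
      using Node by (simp add: Node_in_trees_iff)
    ultimately show ?case
      by (simp only: dhat.simps \<delta>'_def[of a "map (dhat \<delta>') ts"] comp)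
  qed
  have "\<delta>' a ns \<in> e ` f ` trees \<Sigma>" if a: "a \<in> \<Sigma> (length ns)" and "set ns \<subseteq> e ` f ` trees \<Sigma>" for a ns
  proof -
    \<comment> \<open>For closure under transitions, each state is the code of the value of an
      actual tree, so \<open>comp\<close> can be applied to representatives.\<close>
    have "\<forall>n\<in>set ns. \<exists>t. t \<in> trees \<Sigma> \<and> n = e (f t)"
      using that(2) by auto
    then obtain g :: "nat \<Rightarrow> 'a tree" where "\<forall>n\<in>set ns. g n \<in> trees \<Sigma> \<and> n = e (f (g n))"
      by (auto dest: bchoice)
    then obtain ts where ts: "set ts \<subseteq> trees \<Sigma>" "ns = map (\<lambda>t. e (f t)) ts"
      by (intro that[of "map g ns"]) (auto simp: map_idI)
    then have "map d ns = map f ts"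
      using d by auto
    moreover have "Node a ts \<in> trees \<Sigma>"
      using a ts by (simp add: Node_in_trees_iff)
    ultimately show ?thesis
      unfolding \<delta>'_def using comp by (metis imageI)
  qed
  moreover have "{t \<in> trees \<Sigma>. P (f t)} =
      {t \<in> trees \<Sigma>. dhat \<delta>' t \<in> e ` {c \<in> f ` trees \<Sigma>. P c}}"
    using dhat d by (auto simp: image_iff) metis+
  ultimately show ?thesis
    unfolding recognizable_def using fin
    by (intro exI[of _ "e ` f ` trees \<Sigma>"] exI[of _ "e ` {c \<in> f ` trees \<Sigma>. P c}"] exI[of _ \<delta>']) auto
qed

text \<open>This is the product of the automata for the languages in \<open>\<L>\<close>: one state
  answers all look-ahead questions at once.\<close>

lemma recognizable_joint:
  assumes "finite \<L>" and "\<And>L. L \<in> \<L> \<Longrightarrow> recognizable \<Delta> L"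
  obtains f :: "'a tree \<Rightarrow> 'a tree set \<Rightarrow> nat" and \<delta> P where
    "finite (f ` trees \<Delta>)"
    "\<And>a ts. Node a ts \<in> trees \<Delta> \<Longrightarrow> f (Node a ts) = \<delta> a (map f ts)"
    "\<And>L t. L \<in> \<L> \<Longrightarrow> t \<in> trees \<Delta> \<Longrightarrow> t \<in> L \<longleftrightarrow> P L (f t)"
proof -
  have "\<forall>L\<in>\<L>. \<exists>Q F d. finite Q \<and> F \<subseteq> Q \<and>
      (\<forall>k. \<forall>a\<in>\<Delta> k. \<forall>ps. length ps = k \<and> set ps \<subseteq> Q \<longrightarrow> d a ps \<in> Q) \<and>
      L = {t \<in> trees \<Delta>. dhat d t \<in> F}"
    using assms(2) unfolding recognizable_def by (rule ballI)
  from bchoice[OF this] obtain Q where "\<forall>L\<in>\<L>. \<exists>F d. finite (Q L) \<and> F \<subseteq> Q L \<and>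
      (\<forall>k. \<forall>a\<in>\<Delta> k. \<forall>ps. length ps = k \<and> set ps \<subseteq> Q L \<longrightarrow> d a ps \<in> Q L) \<and>
      L = {t \<in> trees \<Delta>. dhat d t \<in> F}" ..
  from bchoice[OF this] obtain F where "\<forall>L\<in>\<L>. \<exists>d. finite (Q L) \<and> F L \<subseteq> Q L \<and>
      (\<forall>k. \<forall>a\<in>\<Delta> k. \<forall>ps. length ps = k \<and> set ps \<subseteq> Q L \<longrightarrow> d a ps \<in> Q L) \<and>
      L = {t \<in> trees \<Delta>. dhat d t \<in> F L}" ..
  from bchoice[OF this] obtain d where d: "\<forall>L\<in>\<L>. finite (Q L) \<and> F L \<subseteq> Q L \<and>
      (\<forall>k. \<forall>a\<in>\<Delta> k. \<forall>ps. length ps = k \<and> set ps \<subseteq> Q L \<longrightarrow> d L a ps \<in> Q L) \<and>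
      L = {t \<in> trees \<Delta>. dhat (d L) t \<in> F L}" ..
  have Q: "finite (Q L)" "a \<in> \<Delta> (length ps) \<Longrightarrow> set ps \<subseteq> Q L \<Longrightarrow> d L a ps \<in> Q L"
      "L = {t \<in> trees \<Delta>. dhat (d L) t \<in> F L}" if "L \<in> \<L>" for L a ps
    using bspec[OF d that] by (elim conjE, simp)+
  \<comment> \<open>Restriction to \<open>\<L>\<close> makes the state tuples extensional, so they
    lie in the finite set \<open>PiE \<L> Q\<close>.\<close>
  define f where "f t = (\<lambda>L\<in>\<L>. dhat (d L) t)" for t
  define \<delta> where "\<delta> a gs = (\<lambda>L\<in>\<L>. d L a (map (\<lambda>g. g L) gs))" for a gs
  have "dhat (d L) t \<in> Q L" if "t \<in> trees \<Delta>" "L \<in> \<L>" for t L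
    using that(1)
  proof (induction rule: trees_induct)
    case (Node a ts)
    then show ?case
      using Q(2)[OF that(2), of a "map (dhat (d L)) ts"] by auto
  qed
  then have "f ` trees \<Delta> \<subseteq> PiE \<L> Q"
    by (auto simp: f_def)
  then have "finite (f ` trees \<Delta>)"
    by (rule finite_subset) (intro finite_PiE assms(1) Q(1))
  moreover have "f (Node a ts) = \<delta> a (map f ts)" for a ts
    by (auto simp: f_def \<delta>_def fun_eq_iff comp_def cong: map_cong)
  moreover have "t \<in> L \<longleftrightarrow> f t L \<in> F L" if "L \<in> \<L>" "t \<in> trees \<Delta>" for t L
    using Q(3)[OF that(1)] that by (auto simp: f_def)
  ultimately show ?thesis
    using that[of f \<delta> "\<lambda>L g. g L \<in> F L"] by blast
qed

fun alg :: "('a \<Rightarrow> 'b list \<Rightarrow> 'b) \<Rightarrow> (nat \<Rightarrow> 'b) \<Rightarrow> 'a tree \<Rightarrow> 'b" where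
  "alg \<delta> \<rho> (Var i) = \<rho> i"
| "alg \<delta> \<rho> (Node a ts) = \<delta> a (map (alg \<delta> \<rho>) ts)"

text \<open>Since \<open>f\<close> is a homomorphism into the algebra \<open>\<delta>\<close>,
  evaluation commutes with substitution. Look-ahead inside a pattern therefore depends only on the
  values of \<open>f\<close> at the substituted trees.\<close>

lemma alg_subst:
  assumes "u \<in> trees_over \<Delta> (xvars k)"
    and comp: "\<And>a ts. Node a ts \<in> trees \<Delta> \<Longrightarrow> f (Node a ts) = \<delta> a (map f ts)"
    and "\<And>i. i < k \<Longrightarrow> \<eta> i \<in> trees \<Delta>" and "\<And>i. i < k \<Longrightarrow> \<rho> i = f (\<eta> i)"
  shows "subst \<eta> u \<in> trees \<Delta> \<and> f (subst \<eta> u) = alg \<delta> \<rho> u"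
  using assms(1)
proof (induction rule: trees_over.induct)
  case (node a ts)
  then have "Node a (map (subst \<eta>) ts) \<in> trees \<Delta>"
    by (auto simp: Node_in_trees_iff)
  moreover have "map f (map (subst \<eta>) ts) = map (alg \<delta> \<rho>) ts"
    using node by auto
  ultimately show ?case
    by (simp only: subst.simps alg.simps comp simp_thms)
qed (use assms(3,4) in \<open>auto simp: xvars_def\<close>)

lemma hom_in_trees:
  assumes "\<And>k a. a \<in> \<Sigma> k \<Longrightarrow> h k a \<in> trees_over \<Delta> (xvars k)" and "s \<in> trees \<Sigma>"
  shows "hom_ext h s \<in> trees \<Delta>"
  using assms(2)
proof (induction rule: trees_induct)
  case (Node a ss)
  then show ?case
    by (auto simp: xvars_def intro!: subst_in_trees_over[OF assms(1)])
qed

text \<open>The states of the second transducer avoid its own alphabets but may occur in the input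
  alphabet of the homomorphism. The infinite universe leaves room to rename them.\<close>

lemma exists_fresh_renaming:
  fixes Q Z :: "'a::infinite set"
  assumes "finite Q" and "finite Z"
  obtains \<rho> :: "'a \<Rightarrow> 'a" where "inj_on \<rho> Q" and "\<rho> ` Q \<inter> Z = {}"
proof -
  have "infinite (- Z)"
    using assms(2) by (simp add: Compl_eq_Diff_UNIV Diff_infinite_finite infinite_UNIV)
  then obtain B where B: "finite B" "card B = card Q" "B \<subseteq> - Z"
    using infinite_arbitrarily_large by metis
  obtain \<rho> where "bij_betw \<rho> Q B"
    using finite_same_card_bij[OF assms(1) B(1)] B(2) by auto
  then show ?thesis
    using B(3) by (intro that[of \<rho>]) (auto simp: bij_betw_def)
qed

lemma finite_ranked_alphabet:
  assumes "ranked_alphabet \<Sigma>"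
  shows "finite (\<Union>k. \<Sigma> k)"
proof -
  have "(\<Union>k. \<Sigma> k) = (\<Union>k\<in>{k. \<Sigma> k \<noteq> {}}. \<Sigma> k)"
    by auto
  then show ?thesis
    using assms by (simp add: ranked_alphabet_def)
qed

lemma HOM_comp_in_T':
  fixes N :: "'a::infinite tdtt"
  assumes N: "tdtt_la N" and \<Sigma>: "ranked_alphabet \<Sigma>"
    and h: "\<And>k a. a \<in> \<Sigma> k \<Longrightarrow> h k a \<in> trees_over (inp N) (xvars k)"
  shows "(\<Sigma>, out N, {(t, hom_ext h t) | t. t \<in> trees \<Sigma>} O realized N) \<in> T'"
proof -
  let ?\<Delta> = "inp N" and ?H = "hom_ext h"
  \<comment> \<open>Only positions below the rank are taken: there the look-ahead is known to be
    recognizable, and there are finitely many of them.\<close>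
  let ?\<L> = "\<Union>r\<in>rules N. look r ` {..<rank r}"
  have H: "?H s \<in> trees ?\<Delta>" if "s \<in> trees \<Sigma>" for s
    using hom_in_trees h that by blast
  have finN: "finite (states N)" "ranked_alphabet (out N)" "initial N \<subseteq> states N"
    using N by (auto simp: tdtt_la_def)
  obtain f :: "'a tree \<Rightarrow> 'a tree set \<Rightarrow> nat" and \<delta> P where
    fin_f: "finite (f ` trees ?\<Delta>)" and
    comp: "\<And>a ts. Node a ts \<in> trees ?\<Delta> \<Longrightarrow> f (Node a ts) = \<delta> a (map f ts)" and
    P: "\<And>L t. L \<in> ?\<L> \<Longrightarrow> t \<in> trees ?\<Delta> \<Longrightarrow> t \<in> L \<longleftrightarrow> P L (f t)"
    by (rule recognizable_joint[of ?\<L> ?\<Delta>]) (use tdtt_laD(6,7)[OF N] in auto)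
  obtain \<rho> where \<rho>: "inj_on \<rho> (states N)" "\<rho> ` states N \<inter> ((\<Union>k. \<Sigma> k) \<union> (\<Union>k. out N k)) = {}"
    using exists_fresh_renaming finN(1) finite_ranked_alphabet[OF \<Sigma>]
      finite_ranked_alphabet[OF finN(2)] by (metis finite_Un)
  \<comment> \<open>\<open>ps\<close> guesses the joint look-ahead states at the images of the subtrees\<close>
  define sym where "sym ps = trun N (\<lambda>r i u. P (look r i) (alg \<delta> ((!) ps) u))
      (\<lambda>q i. {Node (\<rho> q) [Var i]})" for ps
  \<comment> \<open>At a variable of the pattern \<open>sym\<close> leaves a renamed call, so its
    results can serve as right-hand sides \<open>w\<close>. The look-ahead of the new rule verifies
    the guess \<open>ps\<close>.\<close>
  define mk where "mk q a k ps w = \<lparr>rstate = \<rho> q, rsym = a, rank = k, rhs = w,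
      look = \<lambda>i. {s \<in> trees \<Sigma>. f (?H s) = ps ! i}\<rparr>" for q a k ps w
  define Rs where "Rs = (\<Union>k\<in>{k. \<Sigma> k \<noteq> {}}. \<Union>a\<in>\<Sigma> k. \<Union>q\<in>states N.
      \<Union>ps\<in>{ps. set ps \<subseteq> f ` trees ?\<Delta> \<and> length ps = k}. mk q a k ps ` sym ps q (h k a))"
  define M where "M = \<lparr>states = \<rho> ` states N, inp = \<Sigma>, out = out N, rules = Rs,
      initial = \<rho> ` initial N\<rparr>"
  have disj: "disj (\<rho> ` states N) (out N)"
    using \<rho>(2) by blast
  \<comment> \<open>The map sending \<open>s\<close> to \<open>f (?H s)\<close> is compositional
    over \<open>\<Sigma>\<close>: at a node, evaluate the pattern \<open>h\<close> assigns to the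
    symbol, with the values of the subtrees at the variables.\<close>
  have look: "recognizable \<Sigma> {s \<in> trees \<Sigma>. f (?H s) = c}" for c
  proof (rule recognizable_compositional[where f = "\<lambda>s. f (?H s)" and P = "\<lambda>x. x = c"
        and \<delta> = "\<lambda>a gs. alg \<delta> ((!) gs) (h (length gs) a)"])
    show "finite ((\<lambda>s. f (?H s)) ` trees \<Sigma>)"
      by (rule finite_subset[OF _ fin_f]) (use H in auto)
    show "f (?H (Node a ss)) = alg \<delta> ((!) (map (\<lambda>s. f (?H s)) ss))
        (h (length (map (\<lambda>s. f (?H s)) ss)) a)"
      if "Node a ss \<in> trees \<Sigma>" for a ss
    proof -
      have a: "a \<in> \<Sigma> (length ss)" and ss: "set ss \<subseteq> trees \<Sigma>"
        using that by (auto simp: Node_in_trees_iff)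
      have "?H (ss ! i) \<in> trees ?\<Delta>" if "i < length ss" for i
        using ss that by (intro H) auto
      then show ?thesis
        unfolding hom_ext.simps length_map
        by (intro conjunct2[OF alg_subst[where f = f and \<delta> = \<delta>, OF h[OF a] comp]]) auto
    qed
  qed
  have sym_sub: "sym ps q (h k a) \<subseteq> trees_over (out N) (calls (\<rho> ` states N) (xvars k))"
    if "q \<in> states N" "a \<in> \<Sigma> k" for ps q k a
    unfolding sym_def using that
    by (intro run_in_trees_over[OF N h]) (auto simp: xvars_def intro!: trees_over.base)
  have M: "tdtt_la M"
  proof -
    have "finite (sym ps q (h k a))" if "a \<in> \<Sigma> k" for ps q k a
      unfolding sym_def using that by (intro finite_run[OF N h]) auto
    then have "finite Rs"
      unfolding Rs_def using \<Sigma> finN(1) finite_lists_length_eq[OF fin_f]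
      by (auto simp: ranked_alphabet_def intro!: finite_UN_I)
    moreover have "wf_rule M r" if "r \<in> Rs" for r
      using that sym_sub look
      by (fastforce simp: Rs_def wf_rule_def M_def mk_def state_calls_def)
    moreover have "\<rho> ` states N \<inter> (\<Union>k. \<Sigma> k \<union> out N k) = {}"
      using \<rho>(2) by blast
    ultimately show ?thesis
      using \<Sigma> finN by (auto simp: tdtt_la_def M_def)
  qed
  have tr_eq: "tr M (\<rho> q) s = tr N q (?H s)" if "s \<in> trees \<Sigma>" "q \<in> states N" for s q
    using that
  proof (induction arbitrary: q rule: trees_induct)
    case (Node a ss)
    let ?k = "length ss" and ?ps = "map (\<lambda>s. f (?H s)) ss"
    let ?R = "\<lambda>p x. tr M p (subst ((!) ss) x)"
    \<comment> \<open>The look-ahead lets exactly one guess through, the list \<open>?ps\<close> of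
      actual values, and injectivity of \<open>\<rho>\<close> determines the state.\<close>
    have idx: "{r\<in>rules M. rstate r = \<rho> q \<and> rsym r = a \<and> rank r = ?k \<and>
        (\<forall>i<?k. ss ! i \<in> look r i)} = mk q a ?k ?ps ` sym ?ps q (h ?k a)" (is "?I = _")
    proof (intro subset_antisym subsetI)
      fix r assume r: "r \<in> ?I"
      then have "r \<in> Rs" and ra: "rank r = ?k" "rsym r = a"
        by (auto simp: M_def)
      then obtain k b q' ps w where r0: "q' \<in> states N" "r = mk q' b k ps w" "length ps = k"
          "w \<in> sym ps q' (h k b)"
        unfolding Rs_def by blast
      moreover have "k = ?k" "b = a"
        using ra r0(2) by (simp_all add: mk_def)
      ultimately have r': "q' \<in> states N" "r = mk q' a ?k ps w" "length ps = ?k"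
          "w \<in> sym ps q' (h ?k a)"
        by simp_all
      have "q' = q"
        using r r' Node.prems \<rho>(1) by (auto simp: mk_def inj_on_def)
      moreover have "ps = ?ps"
        using r r' by (intro nth_equalityI) (auto simp: mk_def)
      ultimately show "r \<in> mk q a ?k ?ps ` sym ?ps q (h ?k a)"
        using r' by blast
    next
      fix r assume r: "r \<in> mk q a ?k ?ps ` sym ?ps q (h ?k a)"
      have "set ?ps \<subseteq> f ` trees ?\<Delta>"
        using Node(2) H by auto
      then have ps: "?ps \<in> {ps. set ps \<subseteq> f ` trees ?\<Delta> \<and> length ps = ?k}"
        by simp
      have k: "?k \<in> {k. \<Sigma> k \<noteq> {}}"
        using Node(1) by auto
      have "r \<in> Rs"
        unfolding Rs_def
        by (rule UN_I[OF k], rule UN_I[OF Node(1)], rule UN_I[OF Node.prems], rule UN_I[OF ps], rule r)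
      moreover have "\<forall>i<?k. ss ! i \<in> trees \<Sigma>"
        using Node(2) nth_mem by blast
      ultimately show "r \<in> ?I"
        using r by (auto simp: M_def mk_def)
    qed
    have "tr M (\<rho> q) (Node a ss) = (\<Union>w\<in>sym ?ps q (h ?k a). expand (\<rho> ` states N) ?R w)"
      unfolding run_Node[OF M] idx by (simp add: mk_def M_def)
    \<comment> \<open>The second stage of \<open>run_subst\<close> is here \<open>M\<close> itself:
      a renamed call at \<open>Var i\<close> expands to the results of \<open>M\<close> on
      \<open>ss ! i\<close>, which by the induction hypothesis are those of \<open>N\<close> on the
      image of that subtree.\<close>
    also have "\<dots> = tr N q (subst ((!) (map ?H ss)) (h ?k a))"
      unfolding sym_def
    proof (rule run_subst[OF N disj h[OF Node(1)] _ _ Node.prems, symmetric])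
      fix r i v assume r: "r \<in> rules N" "i < rank r" and v: "v \<in> trees_over ?\<Delta> (xvars ?k)"
      have "?H (ss ! i) \<in> trees ?\<Delta>" if "i < ?k" for i
        using Node(2) that by (intro H) auto
      then have "subst ((!) (map ?H ss)) v \<in> trees ?\<Delta> \<and> f (subst ((!) (map ?H ss)) v) = alg \<delta> ((!) ?ps) v"
        by (intro alg_subst[where f = f and \<delta> = \<delta>, OF v comp]) auto
      then show "P (look r i) (alg \<delta> ((!) ?ps) v) \<longleftrightarrow> subst ((!) (map ?H ss)) v \<in> look r i"
        using P[of "look r i" "subst ((!) (map ?H ss)) v"] r by auto
    next
      fix p i assume "p \<in> states N" "i < ?k"
      then show "tr N p (map ?H ss ! i) =
          (\<Union>w\<in>{Node (\<rho> p) [Var i]}. expand (\<rho> ` states N) ?R w)"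
        using Node.IH[of "ss ! i" p] by simp
    qed
    finally show ?case
      by simp
  qed
  have "{(t, ?H t) | t. t \<in> trees \<Sigma>} O realized N = realized M"
    unfolding realized_eq[OF M] realized_eq[OF N]
    using tr_eq finN(3) H by (fastforce simp: M_def)
  then show ?thesis
    unfolding T'_def using M by (auto simp: M_def intro!: exI[of _ M])
qed

theorem theorem4p85:
  shows "(T' :: 'a::infinite transformation set) = HOM \<odot> LT'"
proof (intro subset_antisym subsetI)
  fix x :: "'a transformation" assume "x \<in> T'"
  then show "x \<in> HOM \<odot> LT'"
    using T'_subset unfolding T'_def by auto
next
  fix x :: "'a transformation" assume "x \<in> HOM \<odot> LT'"
  then show "x \<in> T'"
    unfolding class_comp_def HOM_def LT'_def by (auto intro!: HOM_comp_in_T')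
qed

end
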